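(* For every axiomatic extension $L$ of $\mathrm{MTL}$, $L$ has the Halldén completeness if and only if $L$ enjoys the single chain completeness.
   Context: Monoidal t-norm based logic $\mathrm{MTL}$: formulas are built from a denumerable set of propositional variables with the binary connectives $\&,\land,\to$ and the constant $\bot$. Derived connectives: $\neg\varphi:=\varphi\to\bot$, $\varphi\vee\psi:=((\varphi\to\psi)\to\psi)\land((\psi\to\varphi)\to\varphi)$. Axiom schemata: $(\varphi\to\psi)\to((\psi\to\chi)\to(\varphi\to\chi))$; $(\varphi\&\psi)\to\varphi$; $(\varphi\&\psi)\to(\psi\&\varphi)$; $(\varphi\land\psi)\to\varphi$; $(\varphi\land\psi)\to(\psi\land\varphi)$; $(\varphi\&(\varphi\to\psi))\to(\psi\land\varphi)$; $(\varphi\to(\psi\to\chi))\to((\varphi\&\psi)\to\chi)$; $((\varphi\&\psi)\to\chi)\to(\varphi\to(\psi\to\chi))$; $((\varphi\to\psi)\to\chi)\to(((\psi\to\varphi)\to\chi)\to\chi)$; $\bot\to\varphi$. The only rule is modus ponens. An axiomatic extension $L$ of $\mathrm{MTL}$ is a logic obtained from $\mathrm{MTL}$ by adding axiom schemata; $\vdash_L$ denotes provability in $L$. An $\mathrm{MTL}$-algebra is an algebra $\langle A,*,\Rightarrow,\sqcap,\sqcup,0,1\rangle$ such that $\langle A,\sqcap,\sqcup,0,1\rangle$ is a bounded lattice with minimum $0$ and maximum $1$, $\langle A,*,1\rangle$ is a commutative monoid, $z*x\le y$ iff $z\le x\Rightarrow y$ for all $x,y,z$, and $(x\Rightarrow y)\sqcup(y\Rightarrow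 x)=1$ for all $x,y$. Evaluations interpret $\&,\land,\to,\bot$ by $*,\sqcap,\Rightarrow,0$. An $L$-algebra is an $\mathrm{MTL}$-algebra in which every theorem of $L$ always takes value $1$; an $L$-chain is a totally ordered $L$-algebra. $L$ has the Halldén completeness if for all formulas $\varphi,\psi$ with no variables in common, $\vdash_L\varphi\vee\psi$ implies $\vdash_L\varphi$ or $\vdash_L\psi$. $L$ enjoys the single chain completeness if there is an $L$-chain $\mathcal{A}$ such that, for every formula $\varphi$, $\vdash_L\varphi$ iff every evaluation into $\mathcal{A}$ gives $\varphi$ the value $1$. *)

theory Defs
  imports "HOL-Algebra.Group"
begin

section \<open>Formulas and provability\<close>

datatype fm =
    Var nat
  | Bot                (\<open>\<^bold>\<bottom>\<close>)
  | Strong fm fm       (infixl \<open>\<^bold>&\<close> 70)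
  | Conj fm fm         (infixl \<open>\<^bold>\<and>\<close> 65)
  | Imp fm fm          (infixr \<open>\<^bold>\<rightarrow>\<close> 55)

definition Disj :: "fm \<Rightarrow> fm \<Rightarrow> fm"  (infixl \<open>\<^bold>\<or>\<close> 60) where
  "\<phi> \<^bold>\<or> \<psi> = ((\<phi> \<^bold>\<rightarrow> \<psi>) \<^bold>\<rightarrow> \<psi>) \<^bold>\<and> ((\<psi> \<^bold>\<rightarrow> \<phi>) \<^bold>\<rightarrow> \<phi>)"

primrec vars :: "fm \<Rightarrow> nat set" where
  "vars (Var p) = {p}"
| "vars \<^bold>\<bottom> = {}"
| "vars (\<phi> \<^bold>& \<psi>) = vars \<phi> \<union> vars \<psi>"
| "vars (\<phi> \<^bold>\<and> \<psi>) = vars \<phi> \<union> vars \<psi>"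
| "vars (\<phi> \<^bold>\<rightarrow> \<psi>) = vars \<phi> \<union> vars \<psi>"

primrec fm_subst :: "(nat \<Rightarrow> fm) \<Rightarrow> fm \<Rightarrow> fm" where
  "fm_subst \<sigma> (Var p) = \<sigma> p"
| "fm_subst \<sigma> \<^bold>\<bottom> = \<^bold>\<bottom>"
| "fm_subst \<sigma> (\<phi> \<^bold>& \<psi>) = fm_subst \<sigma> \<phi> \<^bold>& fm_subst \<sigma> \<psi>"
| "fm_subst \<sigma> (\<phi> \<^bold>\<and> \<psi>) = fm_subst \<sigma> \<phi> \<^bold>\<and> fm_subst \<sigma> \<psi>"
| "fm_subst \<sigma> (\<phi> \<^bold>\<rightarrow> \<psi>) = fm_subst \<sigma> \<phi> \<^bold>\<rightarrow> fm_subst \<sigma> \<psi>"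

inductive mtl_axiom :: "fm \<Rightarrow> bool" where
  "mtl_axiom ((\<phi> \<^bold>\<rightarrow> \<psi>) \<^bold>\<rightarrow> ((\<psi> \<^bold>\<rightarrow> \<chi>) \<^bold>\<rightarrow> (\<phi> \<^bold>\<rightarrow> \<chi>)))"
| "mtl_axiom ((\<phi> \<^bold>& \<psi>) \<^bold>\<rightarrow> \<phi>)"
| "mtl_axiom ((\<phi> \<^bold>& \<psi>) \<^bold>\<rightarrow> (\<psi> \<^bold>& \<phi>))"
| "mtl_axiom ((\<phi> \<^bold>\<and> \<psi>) \<^bold>\<rightarrow> \<phi>)"
| "mtl_axiom ((\<phi> \<^bold>\<and> \<psi>) \<^bold>\<rightarrow> (\<psi> \<^bold>\<and> \<phi>))"
| "mtl_axiom ((\<phi> \<^bold>& (\<phi> \<^bold>\<rightarrow> \<psi>)) \<^bold>\<rightarrow> (\<psi> \<^bold>\<and> \<phi>))"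
| "mtl_axiom ((\<phi> \<^bold>\<rightarrow> (\<psi> \<^bold>\<rightarrow> \<chi>)) \<^bold>\<rightarrow> ((\<phi> \<^bold>& \<psi>) \<^bold>\<rightarrow> \<chi>))"
| "mtl_axiom (((\<phi> \<^bold>& \<psi>) \<^bold>\<rightarrow> \<chi>) \<^bold>\<rightarrow> (\<phi> \<^bold>\<rightarrow> (\<psi> \<^bold>\<rightarrow> \<chi>)))"
| "mtl_axiom (((\<phi> \<^bold>\<rightarrow> \<psi>) \<^bold>\<rightarrow> \<chi>) \<^bold>\<rightarrow> (((\<psi> \<^bold>\<rightarrow> \<phi>) \<^bold>\<rightarrow> \<chi>) \<^bold>\<rightarrow> \<chi>))"
| "mtl_axiom (\<^bold>\<bottom> \<^bold>\<rightarrow> \<phi>)"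

text \<open>An axiomatic extension of MTL is presented by an arbitrary (possibly empty or infinite)
  set \<open>L\<close> of formulas read as additional axiom schemata: all their substitution instances
  become axioms.\<close>

inductive provable :: "fm set \<Rightarrow> fm \<Rightarrow> bool"  (infix \<open>\<turnstile>\<close> 50) for L :: "fm set" where
  mtl: "mtl_axiom \<phi> \<Longrightarrow> L \<turnstile> \<phi>"
| schema: "\<phi> \<in> L \<Longrightarrow> L \<turnstile> fm_subst \<sigma> \<phi>"
| mp: "L \<turnstile> \<phi> \<Longrightarrow> L \<turnstile> \<phi> \<^bold>\<rightarrow> \<psi> \<Longrightarrow> L \<turnstile> \<psi>"

definition hallden_complete :: "fm set \<Rightarrow> bool" where
  "hallden_complete L \<longleftrightarrow>
     (\<forall>\<phi> \<psi>. vars \<phi> \<inter> vars \<psi> = {} \<longrightarrow> L \<turnstile> \<phi> \<^bold>\<or> \<psi> \<longrightarrow> L \<turnstile> \<phi> \<or> L \<turnstile> \<psi>)"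


section \<open>MTL-algebras and chains\<close>

record 'a mtl_alg = "'a monoid" +
  residuum :: "'a \<Rightarrow> 'a \<Rightarrow> 'a"  (infixr \<open>\<Rrightarrow>\<index>\<close> 65)
  Meet :: "'a \<Rightarrow> 'a \<Rightarrow> 'a"      (infixl \<open>\<curlywedge>\<index>\<close> 70)
  Join :: "'a \<Rightarrow> 'a \<Rightarrow> 'a"      (infixl \<open>\<curlyvee>\<index>\<close> 65)
  Zero :: 'a                   (\<open>\<zero>\<index>\<close>)

definition alg_le :: "('a, 'b) mtl_alg_scheme \<Rightarrow> 'a \<Rightarrow> 'a \<Rightarrow> bool"  (infix \<open>\<preceq>\<index>\<close> 50) where
  "x \<preceq>\<^bsub>A\<^esub> y \<longleftrightarrow> x \<curlywedge>\<^bsub>A\<^esub> y = x"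

text \<open>The one-element algebra, in which \<open>0 = 1\<close>, is not excluded; up to isomorphism it is the only algebra
  of the inconsistent extension.\<close>

locale mtl_algebra = comm_monoid A for A (structure) +
  assumes residuum_closed: "x \<in> carrier A \<Longrightarrow> y \<in> carrier A \<Longrightarrow> x \<Rrightarrow> y \<in> carrier A"
    and Meet_closed: "x \<in> carrier A \<Longrightarrow> y \<in> carrier A \<Longrightarrow> x \<curlywedge> y \<in> carrier A"
    and Join_closed: "x \<in> carrier A \<Longrightarrow> y \<in> carrier A \<Longrightarrow> x \<curlyvee> y \<in> carrier A"
    and Zero_closed: "\<zero> \<in> carrier A"
    and Meet_comm: "x \<in> carrier A \<Longrightarrow> y \<in> carrier A \<Longrightarrow> x \<curlywedge> y = y \<curlywedge> x"
    and Join_comm: "x \<in> carrier A \<Longrightarrow> y \<in> carrier A \<Longrightarrow> x \<curlyvee> y = y \<curlyvee> x"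
    and Meet_assoc: "x \<in> carrier A \<Longrightarrow> y \<in> carrier A \<Longrightarrow> z \<in> carrier A
      \<Longrightarrow> (x \<curlywedge> y) \<curlywedge> z = x \<curlywedge> (y \<curlywedge> z)"
    and Join_assoc: "x \<in> carrier A \<Longrightarrow> y \<in> carrier A \<Longrightarrow> z \<in> carrier A
      \<Longrightarrow> (x \<curlyvee> y) \<curlyvee> z = x \<curlyvee> (y \<curlyvee> z)"
    and Meet_Join_absorb: "x \<in> carrier A \<Longrightarrow> y \<in> carrier A \<Longrightarrow> x \<curlywedge> (x \<curlyvee> y) = x"
    and Join_Meet_absorb: "x \<in> carrier A \<Longrightarrow> y \<in> carrier A \<Longrightarrow> x \<curlyvee> (x \<curlywedge> y) = x"
    and Zero_least: "x \<in> carrier A \<Longrightarrow> \<zero> \<preceq> x"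
    and One_greatest: "x \<in> carrier A \<Longrightarrow> x \<preceq> \<one>"
    and residuation: "x \<in> carrier A \<Longrightarrow> y \<in> carrier A \<Longrightarrow> z \<in> carrier A
      \<Longrightarrow> z \<otimes> x \<preceq> y \<longleftrightarrow> z \<preceq> (x \<Rrightarrow> y)"
    and prelinearity: "x \<in> carrier A \<Longrightarrow> y \<in> carrier A \<Longrightarrow> (x \<Rrightarrow> y) \<curlyvee> (y \<Rrightarrow> x) = \<one>"

primrec fm_value :: "('a, 'b) mtl_alg_scheme \<Rightarrow> (nat \<Rightarrow> 'a) \<Rightarrow> fm \<Rightarrow> 'a" where
  "fm_value A e (Var p) = e p"
| "fm_value A e \<^bold>\<bottom> = \<zero>\<^bsub>A\<^esub>"
| "fm_value A e (\<phi> \<^bold>& \<psi>) = fm_value A e \<phi> \<otimes>\<^bsub>A\<^esub> fm_value A e \<psi>"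
| "fm_value A e (\<phi> \<^bold>\<and> \<psi>) = fm_value A e \<phi> \<curlywedge>\<^bsub>A\<^esub> fm_value A e \<psi>"
| "fm_value A e (\<phi> \<^bold>\<rightarrow> \<psi>) = fm_value A e \<phi> \<Rrightarrow>\<^bsub>A\<^esub> fm_value A e \<psi>"

definition valid_in :: "('a, 'b) mtl_alg_scheme \<Rightarrow> fm \<Rightarrow> bool" where
  "valid_in A \<phi> \<longleftrightarrow> (\<forall>e. range e \<subseteq> carrier A \<longrightarrow> fm_value A e \<phi> = \<one>\<^bsub>A\<^esub>)"

definition L_algebra :: "fm set \<Rightarrow> ('a, 'b) mtl_alg_scheme \<Rightarrow> bool" where
  "L_algebra L A \<longleftrightarrow> mtl_algebra A \<and> (\<forall>\<phi>. L \<turnstile> \<phi> \<longrightarrow> valid_in A \<phi>)"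

definition L_chain :: "fm set \<Rightarrow> ('a, 'b) mtl_alg_scheme \<Rightarrow> bool" where
  "L_chain L A \<longleftrightarrow> L_algebra L A \<and>
     (\<forall>x \<in> carrier A. \<forall>y \<in> carrier A. x \<preceq>\<^bsub>A\<^esub> y \<or> y \<preceq>\<^bsub>A\<^esub> x)"

text \<open>HOL cannot quantify existentially over types, so the type \<open>'a\<close> from which the carrier
  of the chain is drawn is a parameter. The carrier is an arbitrary subset of \<open>'a\<close>. For
  infinite \<open>'a\<close> the choice does not matter: given a witnessing chain of any size, the
  subalgebra generated by the values of one refuting evaluation for each of the countably
  many unprovable formulas is a countable witnessing chain, and embeds in \<open>'a\<close>.\<close>

definition single_chain_complete :: "'a itself \<Rightarrow> fm set \<Rightarrow> bool" where
  "single_chain_complete _ L \<longleftrightarrow>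
     (\<exists>A :: 'a mtl_alg. L_chain L A \<and> (\<forall>\<phi>. L \<turnstile> \<phi> \<longleftrightarrow> valid_in A \<phi>))"

end

theory Submission
  imports Defs "HOL-Library.Countable_Set"
begin

text \<open>If a single chain refutes \<open>\<phi>\<close> under one evaluation and \<open>\<psi>\<close> under another, and the two formulas
  have no common variable, the evaluations can be glued, and the value of \<open>\<phi> \<^bold>\<or> \<psi>\<close> is the larger of two
  values below 1.

  Conversely, rename the unprovable formulas so that they become pairwise variable-disjoint. By
  Hallden completeness no finite disjunction of them is provable, so a theory maximal among those
  that contain no such disjunction exists. It is prime, because \<open>{\<chi>. \<chi> \<^bold>\<or> \<gamma> \<in> T}\<close> is a
  theory for every theory \<open>T\<close>. Its Lindenbaum algebra is thus a chain, and it refutes every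
  unprovable formula through the corresponding renaming.\<close>

section \<open>Chains and disjunction\<close>

lemma fm_value_cong:
  "(\<And>p. p \<in> vars \<phi> \<Longrightarrow> e p = e' p) \<Longrightarrow> fm_value A e \<phi> = fm_value A e' \<phi>"
  by (induction \<phi>) auto

context mtl_algebra
begin

lemma fm_value_closed:
  assumes "range e \<subseteq> carrier A"
  shows "fm_value A e \<phi> \<in> carrier A"
  using assms
  by (induction \<phi>) (auto simp: Zero_closed Meet_closed residuum_closed)

lemma Meet_idem: "x \<in> carrier A \<Longrightarrow> x \<curlywedge> x = x"
  by (metis Join_Meet_absorb Meet_Join_absorb Meet_closed)

lemma le_antisym:
  "x \<in> carrier A \<Longrightarrow> y \<in> carrier A \<Longrightarrow> x \<preceq> y \<Longrightarrow> y \<preceq> x \<Longrightarrow> x = y"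
  by (metis Meet_comm alg_le_def)

lemma Meet_eq_one_left:
  assumes "x \<in> carrier A" "y \<in> carrier A" "x \<curlywedge> y = \<one>"
  shows "x = \<one>"
  by (metis assms Meet_assoc Meet_idem One_greatest alg_le_def)

lemma residuum_eq_one: "x \<in> carrier A \<Longrightarrow> y \<in> carrier A \<Longrightarrow> x \<Rrightarrow> y = \<one> \<longleftrightarrow> x \<preceq> y"
  using residuation[of x y \<one>] le_antisym[of "x \<Rrightarrow> y" \<one>] One_greatest[of "x \<Rrightarrow> y"]
  by (auto simp: residuum_closed One_greatest)

text \<open>If \<open>x \<preceq> y\<close>, then \<open>x \<Rrightarrow> y\<close> is the unit, and
  the first factor of the meet, being \<open>\<one>\<close>, places this unit below
  \<open>y\<close>. The case \<open>y \<preceq> x\<close> uses the second factor.\<close>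

lemma disj_eq_one:
  assumes x: "x \<in> carrier A" and y: "y \<in> carrier A" and lin: "x \<preceq> y \<or> y \<preceq> x"
    and one: "((x \<Rrightarrow> y) \<Rrightarrow> y) \<curlywedge> ((y \<Rrightarrow> x) \<Rrightarrow> x) = \<one>"
  shows "x = \<one> \<or> y = \<one>"
proof -
  have "(x \<Rrightarrow> y) \<Rrightarrow> y = \<one>" "(y \<Rrightarrow> x) \<Rrightarrow> x = \<one>"
    using one x y Meet_eq_one_left Meet_comm by (metis residuum_closed)+
  then have "(x \<Rrightarrow> y) \<preceq> y" "(y \<Rrightarrow> x) \<preceq> x"
    using x y by (simp_all add: residuum_eq_one residuum_closed)
  then show ?thesis
    using lin x y by (metis One_greatest le_antisym one_closed residuum_eq_one)
qed

end

lemma single_chain_complete_imp_hallden: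
  assumes "single_chain_complete TYPE('a) L"
  shows "hallden_complete L"
  unfolding hallden_complete_def
proof (intro allI impI)
  fix \<phi> \<psi> assume disj: "vars \<phi> \<inter> vars \<psi> = {}" and prov: "L \<turnstile> \<phi> \<^bold>\<or> \<psi>"
  obtain A :: "'a mtl_alg" where chain: "L_chain L A" and comp: "\<And>\<chi>. L \<turnstile> \<chi> \<longleftrightarrow> valid_in A \<chi>"
    using assms unfolding single_chain_complete_def by blast
  interpret mtl_algebra A using chain unfolding L_chain_def L_algebra_def by blast
  show "L \<turnstile> \<phi> \<or> L \<turnstile> \<psi>"
  proof (rule ccontr)
    assume "\<not> (L \<turnstile> \<phi> \<or> L \<turnstile> \<psi>)"
    then obtain e1 e2 where e: "range e1 \<subseteq> carrier A" "fm_value A e1 \<phi> \<noteq> \<one>\<^bsub>A\<^esub>"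
      "range e2 \<subseteq> carrier A" "fm_value A e2 \<psi> \<noteq> \<one>\<^bsub>A\<^esub>"
      unfolding comp valid_in_def by blast
    \<comment> \<open>By disjointness this agrees with \<open>e2\<close> on
      \<open>vars \<psi>\<close>.\<close>
    define e where "e p = (if p \<in> vars \<phi> then e1 p else e2 p)" for p
    have r: "range e \<subseteq> carrier A" using e by (auto simp: e_def)
    have "fm_value A e \<phi> = fm_value A e1 \<phi>" "fm_value A e \<psi> = fm_value A e2 \<psi>"
      using disj by (auto simp: e_def intro!: fm_value_cong)
    moreover have "fm_value A e (\<phi> \<^bold>\<or> \<psi>) = \<one>\<^bsub>A\<^esub>"
      using prov r unfolding comp valid_in_def by blast
    then have "fm_value A e \<phi> = \<one>\<^bsub>A\<^esub> \<or> fm_value A e \<psi> = \<one>\<^bsub>A\<^esub>"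
      using chain r unfolding Disj_def L_chain_def
      by (intro disj_eq_one) (simp_all add: fm_value_closed)
    ultimately show False using e by simp
  qed
qed

section \<open>Theories\<close>

text \<open>Closure under substitution is left out on purpose: a prime theory closed under it would
  contain an implication between two distinct variables, hence the one from verum to falsum, hence
  every formula.\<close>

locale mtl_theory =
  fixes T :: "fm set"
  assumes axiom: "mtl_axiom \<phi> \<Longrightarrow> \<phi> \<in> T"
    and mp: "\<phi> \<in> T \<Longrightarrow> \<phi> \<^bold>\<rightarrow> \<psi> \<in> T \<Longrightarrow> \<psi> \<in> T"
begin

section \<open>Implication and strong conjunction\<close>

lemma trans_imp: "\<phi> \<^bold>\<rightarrow> \<psi> \<in> T \<Longrightarrow> \<psi> \<^bold>\<rightarrow> \<chi> \<in> T \<Longrightarrow> \<phi> \<^bold>\<rightarrow> \<chi> \<in> T"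
  by (meson axiom mp mtl_axiom.intros(1))

lemma curry: "\<phi> \<^bold>& \<psi> \<^bold>\<rightarrow> \<chi> \<in> T \<longleftrightarrow> \<phi> \<^bold>\<rightarrow> \<psi> \<^bold>\<rightarrow> \<chi> \<in> T"
  by (meson axiom mp mtl_axiom.intros(7,8))

lemma strong_left: "\<phi> \<^bold>& \<psi> \<^bold>\<rightarrow> \<phi> \<in> T"
  by (intro axiom mtl_axiom.intros)

lemma strong_comm: "\<phi> \<^bold>& \<psi> \<^bold>\<rightarrow> \<psi> \<^bold>& \<phi> \<in> T"
  by (intro axiom mtl_axiom.intros)

lemma weaken: "\<phi> \<^bold>\<rightarrow> \<psi> \<^bold>\<rightarrow> \<phi> \<in> T"
  using strong_left curry by blast

lemma exchange: "\<phi> \<^bold>\<rightarrow> \<psi> \<^bold>\<rightarrow> \<chi> \<in> T \<Longrightarrow> \<psi> \<^bold>\<rightarrow> \<phi> \<^bold>\<rightarrow> \<chi> \<in> T"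
  using trans_imp[OF strong_comm] curry by blast

lemma refl_imp: "\<phi> \<^bold>\<rightarrow> \<phi> \<in> T"
  using exchange[OF weaken] strong_left mp by blast

lemma weakenI: "\<phi> \<in> T \<Longrightarrow> \<psi> \<^bold>\<rightarrow> \<phi> \<in> T"
  using weaken mp by blast

lemma detach: "\<phi> \<^bold>\<rightarrow> (\<phi> \<^bold>\<rightarrow> \<psi>) \<^bold>\<rightarrow> \<psi> \<in> T"
  using exchange[OF refl_imp] .

lemma strong_mono_left: "\<phi> \<^bold>\<rightarrow> \<psi> \<in> T \<Longrightarrow> \<phi> \<^bold>& \<chi> \<^bold>\<rightarrow> \<psi> \<^bold>& \<chi> \<in> T"
  using trans_imp[of \<phi> \<psi> "\<chi> \<^bold>\<rightarrow> \<psi> \<^bold>& \<chi>"] curry refl_imp by blast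

lemma strong_mono:
  "\<phi> \<^bold>\<rightarrow> \<phi>' \<in> T \<Longrightarrow> \<psi> \<^bold>\<rightarrow> \<psi>' \<in> T \<Longrightarrow> \<phi> \<^bold>& \<psi> \<^bold>\<rightarrow> \<phi>' \<^bold>& \<psi>' \<in> T"
  using trans_imp[OF strong_mono_left trans_imp[OF strong_comm trans_imp[OF strong_mono_left strong_comm]]] .

lemma imp_mono:
  assumes "\<phi>' \<^bold>\<rightarrow> \<phi> \<in> T" "\<psi> \<^bold>\<rightarrow> \<psi>' \<in> T"
  shows "(\<phi> \<^bold>\<rightarrow> \<psi>) \<^bold>\<rightarrow> (\<phi>' \<^bold>\<rightarrow> \<psi>') \<in> T"
proof -
  have "\<phi>' \<^bold>\<rightarrow> (\<phi> \<^bold>\<rightarrow> \<psi>) \<^bold>\<rightarrow> \<psi> \<in> T"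
    by (rule trans_imp[OF assms(1) detach])
  then have "\<phi>' \<^bold>& (\<phi> \<^bold>\<rightarrow> \<psi>) \<^bold>\<rightarrow> \<psi>' \<in> T"
    using trans_imp[OF _ assms(2)] curry by blast
  then show ?thesis using curry exchange by blast
qed

text \<open>Associativity is not among the axioms; it results from currying twice and uncurrying in
  the other grouping.\<close>

lemma strong_assoc_right: "\<phi> \<^bold>& \<psi> \<^bold>& \<chi> \<^bold>\<rightarrow> \<phi> \<^bold>& (\<psi> \<^bold>& \<chi>) \<in> T"
proof -
  have "\<phi> \<^bold>\<rightarrow> (\<psi> \<^bold>& \<chi>) \<^bold>\<rightarrow> (\<phi> \<^bold>& (\<psi> \<^bold>& \<chi>)) \<in> T"
    using curry refl_imp by blast
  then have "\<phi> \<^bold>\<rightarrow> \<psi> \<^bold>\<rightarrow> \<chi> \<^bold>\<rightarrow> (\<phi> \<^bold>& (\<psi> \<^bold>& \<chi>)) \<in> T"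
    by (rule trans_imp[OF _ axiom[OF mtl_axiom.intros(8)]])
  then show ?thesis using curry by blast
qed

text \<open>Reversing the order of the three factors turns this direction into the previous
  one.\<close>

lemma strong_assoc_left: "\<phi> \<^bold>& (\<psi> \<^bold>& \<chi>) \<^bold>\<rightarrow> \<phi> \<^bold>& \<psi> \<^bold>& \<chi> \<in> T"
proof -
  have swap: "\<alpha> \<^bold>& (\<beta> \<^bold>& \<gamma>) \<^bold>\<rightarrow> \<gamma> \<^bold>& \<beta> \<^bold>& \<alpha> \<in> T" for \<alpha> \<beta> \<gamma>
    using trans_imp[OF strong_comm strong_mono_left[OF strong_comm]] .
  show ?thesis
    using trans_imp[OF trans_imp[OF swap strong_assoc_right] swap] .
qed

lemma prelinear_cases: "(\<phi> \<^bold>\<rightarrow> \<psi>) \<^bold>\<rightarrow> \<chi> \<in> T \<Longrightarrow> (\<psi> \<^bold>\<rightarrow> \<phi>) \<^bold>\<rightarrow> \<chi> \<in> T \<Longrightarrow> \<chi> \<in> T"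
  by (meson axiom mp mtl_axiom.intros(9))

section \<open>Lattice connectives\<close>

lemma conj_left: "\<phi> \<^bold>\<and> \<psi> \<^bold>\<rightarrow> \<phi> \<in> T"
  by (intro axiom mtl_axiom.intros)

lemma conj_comm: "\<phi> \<^bold>\<and> \<psi> \<^bold>\<rightarrow> \<psi> \<^bold>\<and> \<phi> \<in> T"
  by (intro axiom mtl_axiom.intros)

lemma conj_right: "\<phi> \<^bold>\<and> \<psi> \<^bold>\<rightarrow> \<psi> \<in> T"
  using trans_imp[OF conj_comm conj_left] .

text \<open>Prelinearity reduces the claim to comparable \<open>\<phi>\<close> and
  \<open>\<psi>\<close>. There the sixth axiom, curried, takes the smaller formula, which
  \<open>\<chi>\<close> implies, to the conjunction.\<close>

lemma conj_greatest:
  assumes "\<chi> \<^bold>\<rightarrow> \<phi> \<in> T" "\<chi> \<^bold>\<rightarrow> \<psi> \<in> T"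
  shows "\<chi> \<^bold>\<rightarrow> \<phi> \<^bold>\<and> \<psi> \<in> T"
proof (rule prelinear_cases)
  have *: "\<alpha> \<^bold>\<rightarrow> (\<alpha> \<^bold>\<rightarrow> \<beta>) \<^bold>\<rightarrow> \<beta> \<^bold>\<and> \<alpha> \<in> T" for \<alpha> \<beta>
    using axiom[OF mtl_axiom.intros(6)] curry by blast
  have **: "\<alpha> \<^bold>\<rightarrow> (\<alpha> \<^bold>\<rightarrow> \<beta>) \<^bold>\<rightarrow> \<alpha> \<^bold>\<and> \<beta> \<in> T" for \<alpha> \<beta>
    using trans_imp[OF axiom[OF mtl_axiom.intros(6)] conj_comm] curry by blast
  show "(\<psi> \<^bold>\<rightarrow> \<phi>) \<^bold>\<rightarrow> \<chi> \<^bold>\<rightarrow> \<phi> \<^bold>\<and> \<psi> \<in> T"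
    by (rule exchange[OF trans_imp[OF assms(2) *]])
  show "(\<phi> \<^bold>\<rightarrow> \<psi>) \<^bold>\<rightarrow> \<chi> \<^bold>\<rightarrow> \<phi> \<^bold>\<and> \<psi> \<in> T"
    by (rule exchange[OF trans_imp[OF assms(1) **]])
qed

lemma conj_mono:
  "\<phi> \<^bold>\<rightarrow> \<phi>' \<in> T \<Longrightarrow> \<psi> \<^bold>\<rightarrow> \<psi>' \<in> T \<Longrightarrow> \<phi> \<^bold>\<and> \<psi> \<^bold>\<rightarrow> \<phi>' \<^bold>\<and> \<psi>' \<in> T"
  by (intro conj_greatest trans_imp[OF conj_left] trans_imp[OF conj_right])

lemma disj_left: "\<phi> \<^bold>\<rightarrow> \<phi> \<^bold>\<or> \<psi> \<in> T"
  unfolding Disj_def using conj_greatest detach weaken by blast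

lemma disj_right: "\<psi> \<^bold>\<rightarrow> \<phi> \<^bold>\<or> \<psi> \<in> T"
  unfolding Disj_def using conj_greatest detach weaken by blast

text \<open>Again a split by prelinearity: once \<open>\<phi>\<close> implies \<open>\<psi>\<close>,
  the first conjunct in \<open>Disj_def\<close> collapses the disjunction to \<open>\<psi>\<close>,
  and symmetrically.\<close>

lemma disj_least:
  assumes "\<phi> \<^bold>\<rightarrow> \<chi> \<in> T" "\<psi> \<^bold>\<rightarrow> \<chi> \<in> T"
  shows "\<phi> \<^bold>\<or> \<psi> \<^bold>\<rightarrow> \<chi> \<in> T"
proof (rule prelinear_cases)
  have "(\<phi> \<^bold>\<rightarrow> \<psi>) \<^bold>\<rightarrow> \<phi> \<^bold>\<or> \<psi> \<^bold>\<rightarrow> \<psi> \<in> T"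
    unfolding Disj_def using conj_left exchange by blast
  then show "(\<phi> \<^bold>\<rightarrow> \<psi>) \<^bold>\<rightarrow> \<phi> \<^bold>\<or> \<psi> \<^bold>\<rightarrow> \<chi> \<in> T"
    using trans_imp[OF _ assms(2)] curry by blast
  have "(\<psi> \<^bold>\<rightarrow> \<phi>) \<^bold>\<rightarrow> \<phi> \<^bold>\<or> \<psi> \<^bold>\<rightarrow> \<phi> \<in> T"
    unfolding Disj_def using conj_right exchange by blast
  then show "(\<psi> \<^bold>\<rightarrow> \<phi>) \<^bold>\<rightarrow> \<phi> \<^bold>\<or> \<psi> \<^bold>\<rightarrow> \<chi> \<in> T"
    using trans_imp[OF _ assms(1)] curry by blast
qed

lemma disj_mono:
  "\<phi> \<^bold>\<rightarrow> \<phi>' \<in> T \<Longrightarrow> \<psi> \<^bold>\<rightarrow> \<psi>' \<in> T \<Longrightarrow> \<phi> \<^bold>\<or> \<psi> \<^bold>\<rightarrow> \<phi>' \<^bold>\<or> \<psi>' \<in> T"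
  by (intro disj_least trans_imp[OF _ disj_left] trans_imp[OF _ disj_right])

lemma disj_prelinear: "(\<phi> \<^bold>\<rightarrow> \<psi>) \<^bold>\<or> (\<psi> \<^bold>\<rightarrow> \<phi>) \<in> T"
  using prelinear_cases disj_left disj_right by blast

lemma disj_comm: "\<phi> \<^bold>\<or> \<psi> \<in> T \<Longrightarrow> \<psi> \<^bold>\<or> \<phi> \<in> T"
  using disj_least disj_left disj_right mp by blast

text \<open>The classical deduction theorem fails in MTL, so adjoining a formula to a theory would
  involve its powers. Passing to this theory avoids them. Modus ponens is a case distinction on both
  premises, where \<open>\<gamma>\<close> alone already yields the conclusion.\<close>

lemma disj_theory: "mtl_theory {\<chi>. \<chi> \<^bold>\<or> \<gamma> \<in> T}"
proof
  show "\<phi> \<in> {\<chi>. \<chi> \<^bold>\<or> \<gamma> \<in> T}" if "mtl_axiom \<phi>" for \<phi>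
    using that axiom disj_left mp by blast
  fix \<phi> \<psi> assume "\<phi> \<in> {\<chi>. \<chi> \<^bold>\<or> \<gamma> \<in> T}" "\<phi> \<^bold>\<rightarrow> \<psi> \<in> {\<chi>. \<chi> \<^bold>\<or> \<gamma> \<in> T}"
  then have 1: "\<phi> \<^bold>\<or> \<gamma> \<in> T" and 2: "(\<phi> \<^bold>\<rightarrow> \<psi>) \<^bold>\<or> \<gamma> \<in> T" by auto
  have "\<phi> \<^bold>\<rightarrow> (\<phi> \<^bold>\<rightarrow> \<psi>) \<^bold>\<rightarrow> \<psi> \<^bold>\<or> \<gamma> \<in> T"
    using trans_imp[OF _ disj_left] detach curry by blast
  moreover have "\<gamma> \<^bold>\<rightarrow> (\<phi> \<^bold>\<rightarrow> \<psi>) \<^bold>\<rightarrow> \<psi> \<^bold>\<or> \<gamma> \<in> T"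
    using trans_imp[OF disj_right weaken] .
  ultimately have "(\<phi> \<^bold>\<rightarrow> \<psi>) \<^bold>\<rightarrow> \<psi> \<^bold>\<or> \<gamma> \<in> T"
    using disj_least 1 mp by blast
  then show "\<psi> \<in> {\<chi>. \<chi> \<^bold>\<or> \<gamma> \<in> T}"
    using disj_least disj_right 2 mp by blast
qed

end

section \<open>Prime extensions of theories\<close>

lemma mtl_theory_provable: "mtl_theory {\<phi>. L \<turnstile> \<phi>}"
  by unfold_locales (auto intro: provable.intros)

lemma mtl_theory_Union_chain:
  assumes "\<C> \<noteq> {}" and chain: "subset.chain \<A> \<C>" and theories: "\<And>T. T \<in> \<C> \<Longrightarrow> mtl_theory T"
  shows "mtl_theory (\<Union>\<C>)"
proof
  show "\<phi> \<in> \<Union>\<C>" if "mtl_axiom \<phi>" for \<phi>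
    using that assms(1) theories mtl_theory.axiom by blast
  fix \<phi> \<psi> assume "\<phi> \<in> \<Union>\<C>" "\<phi> \<^bold>\<rightarrow> \<psi> \<in> \<Union>\<C>"
  then obtain S T where "S \<in> \<C>" "T \<in> \<C>" "\<phi> \<in> S" "\<phi> \<^bold>\<rightarrow> \<psi> \<in> T" by blast
  moreover from this have "S \<subseteq> T \<or> T \<subseteq> S" using chain by (auto simp: subset_chain_def)
  ultimately show "\<psi> \<in> \<Union>\<C>" using theories mtl_theory.mp by blast
qed

text \<open>An analogue of the prime filter theorem: \<open>\<Delta>\<close> acts as a base of an
  ideal, directed with respect to implication in \<open>T\<close>, and a maximal theory avoiding it
  is prime.\<close>

lemma prime_theory_extension:
  assumes T: "mtl_theory T" and avoid: "T \<inter> \<Delta> = {}"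
    and directed: "\<And>\<alpha> \<beta>. \<alpha> \<in> \<Delta> \<Longrightarrow> \<beta> \<in> \<Delta> \<Longrightarrow> \<exists>\<delta>\<in>\<Delta>. \<alpha> \<^bold>\<or> \<beta> \<^bold>\<rightarrow> \<delta> \<in> T"
  obtains P where "mtl_theory P" "T \<subseteq> P" "P \<inter> \<Delta> = {}"
    "\<And>\<alpha> \<beta>. \<alpha> \<^bold>\<or> \<beta> \<in> P \<Longrightarrow> \<alpha> \<in> P \<or> \<beta> \<in> P"
proof -
  define \<A> where "\<A> = {S. mtl_theory S \<and> T \<subseteq> S \<and> S \<inter> \<Delta> = {}}"
  have "\<Union>\<C> \<in> \<A>" if "\<C> \<noteq> {}" and chain: "subset.chain \<A> \<C>" for \<C>
  proof -
    have "\<C> \<subseteq> \<A>" using chain by (simp add: subset_chain_def)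
    then show ?thesis
      using that(1) mtl_theory_Union_chain[OF that] unfolding \<A>_def by blast
  qed
  moreover have "T \<in> \<A>" using T avoid by (simp add: \<A>_def)
  ultimately obtain P where P: "P \<in> \<A>" and max: "\<And>S. S \<in> \<A> \<Longrightarrow> P \<subseteq> S \<Longrightarrow> S = P"
    using subset_Zorn_nonempty[of \<A>] by blast
  interpret mtl_theory P using P by (simp add: \<A>_def)
  \<comment> \<open>The theory \<open>?S\<close> contains \<open>P\<close> and also
    \<open>\<alpha>\<close>, so it is strictly larger than \<open>P\<close> and by maximality must
    meet \<open>\<Delta>\<close>.\<close>
  have hit: "\<exists>\<delta>\<in>\<Delta>. \<delta> \<^bold>\<or> \<gamma> \<in> P" if "\<alpha> \<^bold>\<or> \<gamma> \<in> P" "\<alpha> \<notin> P" for \<alpha> \<gamma>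
  proof (rule ccontr)
    let ?S = "{\<chi>. \<chi> \<^bold>\<or> \<gamma> \<in> P}"
    assume "\<not> (\<exists>\<delta>\<in>\<Delta>. \<delta> \<^bold>\<or> \<gamma> \<in> P)"
    moreover have sub: "P \<subseteq> ?S" using disj_left mp by blast
    ultimately have "?S \<in> \<A>" using disj_theory P unfolding \<A>_def by blast
    then show False using max[OF _ sub] that by blast
  qed
  have "\<alpha> \<in> P \<or> \<beta> \<in> P" if disj: "\<alpha> \<^bold>\<or> \<beta> \<in> P" for \<alpha> \<beta>
  proof (rule ccontr)
    assume *: "\<not> (\<alpha> \<in> P \<or> \<beta> \<in> P)"
    then obtain \<delta>1 where \<delta>1: "\<delta>1 \<in> \<Delta>" "\<delta>1 \<^bold>\<or> \<beta> \<in> P" using disj hit by blast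
    \<comment> \<open>The first use of \<open>hit\<close> replaced \<open>\<alpha>\<close> by
      \<open>\<delta>1\<close>; after commuting, the second replaces \<open>\<beta>\<close>.
      Directedness then merges both into one member of \<open>\<Delta>\<close> lying in
      \<open>P\<close>.\<close>
    then obtain \<delta>2 where \<delta>2: "\<delta>2 \<in> \<Delta>" "\<delta>2 \<^bold>\<or> \<delta>1 \<in> P" using * disj_comm hit by blast
    obtain \<delta> where "\<delta> \<in> \<Delta>" "\<delta>2 \<^bold>\<or> \<delta>1 \<^bold>\<rightarrow> \<delta> \<in> T" using directed \<delta>1 \<delta>2 by blast
    then show False using \<delta>2 P mp unfolding \<A>_def by blast
  qed
  then show thesis using that P unfolding \<A>_def by blast
qed

section \<open>Lindenbaum algebras\<close>

text \<open>A map \<open>f\<close> whose kernel is provable equivalence serves as the quotient map. This keeps the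
  carrier inside the type \<open>'a\<close>.\<close>

locale lindenbaum = mtl_theory +
  fixes f :: "fm \<Rightarrow> 'a"
  assumes kernel: "f \<phi> = f \<psi> \<longleftrightarrow> \<phi> \<^bold>\<rightarrow> \<psi> \<in> T \<and> \<psi> \<^bold>\<rightarrow> \<phi> \<in> T"
begin

definition rep :: "'a \<Rightarrow> fm" where
  "rep x = (SOME \<phi>. f \<phi> = x)"

definition Lind :: "'a mtl_alg" where
  "Lind = \<lparr>carrier = range f, mult = \<lambda>x y. f (rep x \<^bold>& rep y), one = f (\<^bold>\<bottom> \<^bold>\<rightarrow> \<^bold>\<bottom>),
     residuum = \<lambda>x y. f (rep x \<^bold>\<rightarrow> rep y), Meet = \<lambda>x y. f (rep x \<^bold>\<and> rep y),
     Join = \<lambda>x y. f (rep x \<^bold>\<or> rep y), Zero = f \<^bold>\<bottom>\<rparr>"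

lemma f_rep: "f (rep (f \<phi>)) = f \<phi>"
  unfolding rep_def by (rule someI) simp

lemma rep_equiv: "rep (f \<phi>) \<^bold>\<rightarrow> \<phi> \<in> T" "\<phi> \<^bold>\<rightarrow> rep (f \<phi>) \<in> T"
  using f_rep kernel by blast+

text \<open>The operations go through the representatives chosen by \<open>rep\<close>; the
  monotonicity lemmas make the results independent of that choice.\<close>

lemma Lind_simps:
  "carrier Lind = range f"
  "\<one>\<^bsub>Lind\<^esub> = f (\<^bold>\<bottom> \<^bold>\<rightarrow> \<^bold>\<bottom>)"
  "\<zero>\<^bsub>Lind\<^esub> = f \<^bold>\<bottom>"
  "f \<phi> \<otimes>\<^bsub>Lind\<^esub> f \<psi> = f (\<phi> \<^bold>& \<psi>)"
  "f \<phi> \<Rrightarrow>\<^bsub>Lind\<^esub> f \<psi> = f (\<phi> \<^bold>\<rightarrow> \<psi>)"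
  "f \<phi> \<curlywedge>\<^bsub>Lind\<^esub> f \<psi> = f (\<phi> \<^bold>\<and> \<psi>)"
  "f \<phi> \<curlyvee>\<^bsub>Lind\<^esub> f \<psi> = f (\<phi> \<^bold>\<or> \<psi>)"
  by (simp_all add: Lind_def kernel strong_mono imp_mono conj_mono disj_mono rep_equiv)

lemma f_eq_one: "f \<phi> = f (\<^bold>\<bottom> \<^bold>\<rightarrow> \<^bold>\<bottom>) \<longleftrightarrow> \<phi> \<in> T"
  using kernel mp refl_imp weakenI by blast

lemma Lind_le: "f \<phi> \<preceq>\<^bsub>Lind\<^esub> f \<psi> \<longleftrightarrow> \<phi> \<^bold>\<rightarrow> \<psi> \<in> T"
  unfolding alg_le_def Lind_simps kernel
  using conj_greatest[of \<phi> \<phi> \<psi>] conj_left conj_right[of \<phi> \<psi>] refl_imp trans_imp[of \<phi> "\<phi> \<^bold>\<and> \<psi>" \<psi>] by blast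

text \<open>Through \<open>kernel\<close> and \<open>Lind_le\<close>, every law becomes membership
  of implications in \<open>T\<close>; residuation becomes \<open>curry\<close>.\<close>

lemma mtl_algebra_Lind: "mtl_algebra Lind"
proof -
  have unit: "(\<^bold>\<bottom> \<^bold>\<rightarrow> \<^bold>\<bottom>) \<^bold>& \<phi> \<^bold>\<rightarrow> \<phi> \<in> T" "\<phi> \<^bold>\<rightarrow> (\<^bold>\<bottom> \<^bold>\<rightarrow> \<^bold>\<bottom>) \<^bold>& \<phi> \<in> T" for \<phi>
    using trans_imp[OF strong_comm strong_left] curry mp[OF refl_imp] refl_imp by blast+
  have monoid: "comm_monoid Lind"
    by (rule comm_monoidI)
      (auto simp: Lind_simps kernel unit rangeI strong_assoc_left strong_assoc_right strong_comm)
  have assoc: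
    "\<phi> \<^bold>\<and> \<psi> \<^bold>\<and> \<chi> \<^bold>\<rightarrow> \<phi> \<^bold>\<and> (\<psi> \<^bold>\<and> \<chi>) \<in> T" "\<phi> \<^bold>\<and> (\<psi> \<^bold>\<and> \<chi>) \<^bold>\<rightarrow> \<phi> \<^bold>\<and> \<psi> \<^bold>\<and> \<chi> \<in> T"
    "\<phi> \<^bold>\<or> \<psi> \<^bold>\<or> \<chi> \<^bold>\<rightarrow> \<phi> \<^bold>\<or> (\<psi> \<^bold>\<or> \<chi>) \<in> T" "\<phi> \<^bold>\<or> (\<psi> \<^bold>\<or> \<chi>) \<^bold>\<rightarrow> \<phi> \<^bold>\<or> \<psi> \<^bold>\<or> \<chi> \<in> T" for \<phi> \<psi> \<chi>
    by (intro conj_greatest disj_least conj_left conj_right disj_left disj_right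
        trans_imp[OF conj_left conj_left] trans_imp[OF conj_left conj_right]
        trans_imp[OF conj_right conj_left] trans_imp[OF conj_right conj_right]
        trans_imp[OF disj_left disj_left] trans_imp[OF disj_left disj_right]
        trans_imp[OF disj_right disj_left] trans_imp[OF disj_right disj_right])+
  have "\<^bold>\<bottom> \<^bold>\<rightarrow> \<phi> \<in> T" for \<phi>
    by (intro axiom mtl_axiom.intros)
  then show ?thesis
    by (intro mtl_algebra.intro mtl_algebra_axioms.intro monoid)
      (auto simp: Lind_simps Lind_le kernel f_eq_one assoc curry refl_imp weakenI disj_prelinear rangeI
        conj_comm conj_greatest conj_left disj_least disj_left disj_right)
qed

lemma fm_value_Lind: "fm_value Lind (\<lambda>p. f (\<sigma> p)) \<phi> = f (fm_subst \<sigma> \<phi>)"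
  by (induction \<phi>) (simp_all add: Lind_simps)

text \<open>Evaluations into \<open>range f\<close> are exactly the maps \<open>f\<close> after a
  substitution, so one algebra tests all instances of \<open>\<phi>\<close> at once.\<close>

lemma valid_in_Lind: "valid_in Lind \<phi> \<longleftrightarrow> (\<forall>\<sigma>. fm_subst \<sigma> \<phi> \<in> T)"
proof
  assume *: "valid_in Lind \<phi>"
  show "\<forall>\<sigma>. fm_subst \<sigma> \<phi> \<in> T"
  proof
    fix \<sigma> :: "nat \<Rightarrow> fm"
    have "range (\<lambda>p. f (\<sigma> p)) \<subseteq> carrier Lind" by (auto simp: Lind_simps)
    then show "fm_subst \<sigma> \<phi> \<in> T"
      using * fm_value_Lind[of \<sigma> \<phi>] by (simp add: valid_in_def flip: f_eq_one Lind_simps(2))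
  qed
next
  assume *: "\<forall>\<sigma>. fm_subst \<sigma> \<phi> \<in> T"
  show "valid_in Lind \<phi>"
    unfolding valid_in_def
  proof (intro allI impI)
    fix e :: "nat \<Rightarrow> 'a" assume "range e \<subseteq> carrier Lind"
    then have "\<forall>p. \<exists>\<psi>. e p = f \<psi>" by (auto simp: Lind_simps)
    then obtain \<sigma> where "e = (\<lambda>p. f (\<sigma> p))" by metis
    then show "fm_value Lind e \<phi> = \<one>\<^bsub>Lind\<^esub>"
      using * by (simp add: fm_value_Lind Lind_simps f_eq_one)
  qed
qed

end

section \<open>Substitutions and renaming apart\<close>

instance fm :: countable
  by countable_datatype

lemma fm_subst_compose: "fm_subst \<sigma> (fm_subst \<tau> \<phi>) = fm_subst (\<lambda>p. fm_subst \<sigma> (\<tau> p)) \<phi>"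
  by (induction \<phi>) simp_all

lemma fm_subst_Var: "fm_subst Var \<phi> = \<phi>"
  by (induction \<phi>) simp_all

lemma vars_fm_subst: "vars (fm_subst \<sigma> \<phi>) = (\<Union>p\<in>vars \<phi>. vars (\<sigma> p))"
  by (induction \<phi>) auto

lemma mtl_axiom_fm_subst: "mtl_axiom \<phi> \<Longrightarrow> mtl_axiom (fm_subst \<sigma> \<phi>)"
  by (induction rule: mtl_axiom.induct) (auto intro: mtl_axiom.intros)

lemma provable_fm_subst: "L \<turnstile> \<phi> \<Longrightarrow> L \<turnstile> fm_subst \<sigma> \<phi>"
  by (induction rule: provable.induct)
    (auto simp: fm_subst_compose intro: provable.intros mtl_axiom_fm_subst)

text \<open>Pairing the index with the variable gives each \<open>i\<close> its own infinite supply
  of variables, disjoint from that of any other index.\<close>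

definition rename :: "nat \<Rightarrow> fm \<Rightarrow> fm" where
  "rename i = fm_subst (\<lambda>p. Var (prod_encode (i, p)))"

lemma provable_rename: "L \<turnstile> rename i \<phi> \<longleftrightarrow> L \<turnstile> \<phi>"
proof
  assume "L \<turnstile> rename i \<phi>"
  \<comment> \<open>Projecting to the second component undoes the renaming.\<close>
  then have "L \<turnstile> fm_subst (\<lambda>q. Var (snd (prod_decode q))) (rename i \<phi>)"
    by (rule provable_fm_subst)
  then show "L \<turnstile> \<phi>" by (simp add: rename_def fm_subst_compose fm_subst_Var)
qed (simp add: rename_def provable_fm_subst)

lemma vars_rename: "vars (rename i \<phi>) = (\<lambda>p. prod_encode (i, p)) ` vars \<phi>"
  by (auto simp: rename_def vars_fm_subst)

section \<open>Finite disjunctions of renamed formulas\<close>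

primrec disj_upto :: "(nat \<Rightarrow> fm) \<Rightarrow> nat \<Rightarrow> fm" where
  "disj_upto s 0 = s 0"
| "disj_upto s (Suc n) = disj_upto s n \<^bold>\<or> s (Suc n)"

lemma vars_disj_upto: "vars (disj_upto s n) = (\<Union>i\<le>n. vars (s i))"
  by (induction n) (auto simp: Disj_def atMost_Suc)

text \<open>Each new disjunct is renamed by its own position and so shares no variable with the
  earlier ones; Hallden completeness splits it off.\<close>

lemma hallden_disj_upto_rename:
  assumes "hallden_complete L" and "\<And>i. \<not> L \<turnstile> s i"
  shows "\<not> L \<turnstile> disj_upto (\<lambda>i. rename i (s i)) n"
proof (induction n)
  case 0
  show ?case using assms(2) by (simp add: provable_rename)
next
  case (Suc n)
  have "vars (disj_upto (\<lambda>i. rename i (s i)) n) \<inter> vars (rename (Suc n) (s (Suc n))) = {}"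
    by (auto simp: vars_disj_upto vars_rename)
  then show ?case
    using Suc assms unfolding hallden_complete_def disj_upto.simps by (metis provable_rename)
qed

context mtl_theory
begin

lemma disj_upto_mono: "m \<le> n \<Longrightarrow> disj_upto s m \<^bold>\<rightarrow> disj_upto s n \<in> T"
  by (induction rule: dec_induct) (auto intro: refl_imp disj_left trans_imp)

lemma disj_upto_upper: "s n \<^bold>\<rightarrow> disj_upto s n \<in> T"
  by (cases n) (auto intro: refl_imp disj_right)

end

lemma hallden_imp_prime_theory:
  assumes "hallden_complete L"
  obtains P where "mtl_theory P" "{\<phi>. L \<turnstile> \<phi>} \<subseteq> P"
    "\<And>\<alpha> \<beta>. \<alpha> \<^bold>\<or> \<beta> \<in> P \<Longrightarrow> \<alpha> \<in> P \<or> \<beta> \<in> P"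
    "\<And>\<phi>. \<not> L \<turnstile> \<phi> \<Longrightarrow> \<exists>\<sigma>. fm_subst \<sigma> \<phi> \<notin> P"
proof (cases "\<exists>\<phi>. \<not> L \<turnstile> \<phi>")
  case False
  \<comment> \<open>For an inconsistent \<open>L\<close> the refutation condition is vacuous, and
    \<open>UNIV\<close> leads to the one-element algebra.\<close>
  then show thesis using that[of UNIV] by (simp add: mtl_theory_def)
next
  case True
  \<comment> \<open>Countability of \<open>fm\<close> gives the enumeration. Repetitions are
    harmless, since renaming depends on the position.\<close>
  then obtain s :: "nat \<Rightarrow> fm" where s: "range s = {\<phi>. \<not> L \<turnstile> \<phi>}"
    using range_from_nat_into[of "{\<phi>. \<not> L \<turnstile> \<phi>}"] by blast
  define D where "D = disj_upto (\<lambda>i. rename i (s i))"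
  interpret prov: mtl_theory "{\<phi>. L \<turnstile> \<phi>}" by (rule mtl_theory_provable)
  have avoid: "{\<phi>. L \<turnstile> \<phi>} \<inter> range D = {}"
    using hallden_disj_upto_rename[OF assms] s unfolding D_def by blast
  have directed: "\<exists>\<delta>\<in>range D. \<alpha> \<^bold>\<or> \<beta> \<^bold>\<rightarrow> \<delta> \<in> {\<phi>. L \<turnstile> \<phi>}"
    if *: "\<alpha> \<in> range D" "\<beta> \<in> range D" for \<alpha> \<beta>
  proof -
    obtain m n where "\<alpha> = D m" "\<beta> = D n" using * by blast
    then have "\<alpha> \<^bold>\<or> \<beta> \<^bold>\<rightarrow> D (max m n) \<in> {\<phi>. L \<turnstile> \<phi>}"
      unfolding D_def
      by (intro prov.disj_least) (simp_all only: prov.disj_upto_mono max.cobounded1 max.cobounded2)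
    then show ?thesis by blast
  qed
  obtain P where P: "mtl_theory P" "{\<phi>. L \<turnstile> \<phi>} \<subseteq> P" "P \<inter> range D = {}"
    "\<And>\<alpha> \<beta>. \<alpha> \<^bold>\<or> \<beta> \<in> P \<Longrightarrow> \<alpha> \<in> P \<or> \<beta> \<in> P"
    using prime_theory_extension[OF mtl_theory_provable avoid directed] by blast
  have "\<exists>\<sigma>. fm_subst \<sigma> \<phi> \<notin> P" if "\<not> L \<turnstile> \<phi>" for \<phi>
  proof -
    obtain n where n: "\<phi> = s n" using s \<open>\<not> L \<turnstile> \<phi>\<close> by blast
    interpret mtl_theory P by fact
    \<comment> \<open>The renamed copy implies \<open>D n\<close>, which \<open>P\<close>
      avoids.\<close>
    have "rename n (s n) \<notin> P"
      using disj_upto_upper[of "\<lambda>i. rename i (s i)" n] mp P(3) unfolding D_def by blast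
    then show ?thesis unfolding n rename_def by blast
  qed
  then show thesis using that P by blast
qed

text \<open>There are only countably many classes of formulas, so an infinite \<open>'a\<close> has
  room for them: \<open>g\<close> embeds the code of a chosen representative.\<close>

lemma (in mtl_theory) lindenbaum_map_exists:
  assumes "infinite (UNIV :: 'a set)"
  obtains f :: "fm \<Rightarrow> 'a" where "lindenbaum T f"
proof -
  obtain g :: "nat \<Rightarrow> 'a" where g: "inj g"
    using assms infinite_countable_subset by blast
  define equiv where "equiv \<phi> \<psi> \<longleftrightarrow> \<phi> \<^bold>\<rightarrow> \<psi> \<in> T \<and> \<psi> \<^bold>\<rightarrow> \<phi> \<in> T" for \<phi> \<psi>
  define f where "f \<phi> = g (to_nat (SOME \<psi>. equiv \<phi> \<psi>))" for \<phi>
  have "f \<phi> = f \<psi> \<longleftrightarrow> equiv \<phi> \<psi>" for \<phi> \<psi>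
  proof
    have some: "equiv \<chi> (SOME \<chi>'. equiv \<chi> \<chi>')" for \<chi>
      by (rule someI[of _ \<chi>]) (simp add: equiv_def refl_imp)
    assume "f \<phi> = f \<psi>"
    then have "(SOME \<chi>. equiv \<phi> \<chi>) = (SOME \<chi>. equiv \<psi> \<chi>)"
      using g by (simp add: f_def inj_eq)
    then have "equiv \<phi> (SOME \<chi>. equiv \<psi> \<chi>)" using some[of \<phi>] by simp
    then show "equiv \<phi> \<psi>" using some[of \<psi>] unfolding equiv_def by (meson trans_imp)
  next
    assume "equiv \<phi> \<psi>"
    \<comment> \<open>Equality as predicates is what makes both \<open>SOME\<close> terms pick the
      same representative.\<close>
    then have "equiv \<phi> = equiv \<psi>" unfolding equiv_def fun_eq_iff by (meson trans_imp)
    then show "f \<phi> = f \<psi>" by (simp add: f_def)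
  qed
  then have "lindenbaum T f"
    by unfold_locales (simp add: equiv_def)
  then show thesis by (rule that)
qed

lemma hallden_imp_single_chain_complete:
  assumes "infinite (UNIV :: 'a set)" and "hallden_complete L"
  shows "single_chain_complete TYPE('a) L"
proof -
  obtain P where P: "mtl_theory P" "{\<phi>. L \<turnstile> \<phi>} \<subseteq> P"
    "\<And>\<alpha> \<beta>. \<alpha> \<^bold>\<or> \<beta> \<in> P \<Longrightarrow> \<alpha> \<in> P \<or> \<beta> \<in> P"
    "\<And>\<phi>. \<not> L \<turnstile> \<phi> \<Longrightarrow> \<exists>\<sigma>. fm_subst \<sigma> \<phi> \<notin> P"
    using hallden_imp_prime_theory[OF assms(2)] by blast
  obtain f :: "fm \<Rightarrow> 'a" where "lindenbaum P f"
    using mtl_theory.lindenbaum_map_exists[OF P(1) assms(1)] by blast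
  then interpret lindenbaum P f .
  have complete: "L \<turnstile> \<phi> \<longleftrightarrow> valid_in Lind \<phi>" for \<phi>
    \<comment> \<open>Theorems have all their instances in \<open>P\<close>; an unprovable formula
      has an instance outside \<open>P\<close>, namely its renamed copy when \<open>P\<close> comes
      from Zorn's lemma.\<close>
    unfolding valid_in_Lind using P(2,4) provable_fm_subst by blast
  moreover have "L_chain L Lind"
    unfolding L_chain_def L_algebra_def
    \<comment> \<open>Primeness applied to the prelinearity disjunction makes any two classes
      comparable.\<close>
    using P(3)[OF disj_prelinear] complete mtl_algebra_Lind by (auto simp: Lind_simps Lind_le)
  ultimately show ?thesis unfolding single_chain_complete_def by blast
qed

theorem corollary3p1:
  fixes L :: "fm set"
  assumes "infinite (UNIV :: 'a set)"
  shows "hallden_complete L \<longleftrightarrow> single_chain_complete TYPE('a) L"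
  using single_chain_complete_imp_hallden hallden_imp_single_chain_complete[OF assms] by blast

end
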